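(* Let $F:\mathbb{R}^d\to\mathbb{R}$ be lower bounded by $F^*$ with $\Delta_1\ge F(x_1)-F^*$, let $F$ be $L$-smooth, and let the gradient oracle $\nabla f(\cdot,\xi)$ satisfy the $p$-BCM assumption with $p\in(1,2]$ and constant $\sigma\ge 0$. Let $q\ge 0$, $\eta>0$, $B>0$ and $r\in(0,1)$. Then for every horizon $T\ge 1$ the iterates $x_1,\dots,x_T$ generated by minibatch-NSGD with parameters $\eta_t\equiv \eta T^{-r}$ and $B_t\equiv\lceil\max\{1,BT^q\}\rceil$ satisfy $$\frac1T\sum_{t=1}^T\mathbb{E}\big[\|\nabla F(x_t)\|\big]\le \frac{\Delta_1}{\eta T^{1-r}}+\frac{\eta L}{2T^r}+\frac{4\sigma}{\max\{1,BT^q\}^{\frac{p-1}{p}}}.$$ Moreover (for $q>0$), the sample complexity, i.e. the number of oracle calls sufficient (for a suitable choice of $T$) to guarantee $\frac1T\sum_{t=1}^T\mathbb{E}[\|\nabla F(x_t)\|]\le\varepsilon$, is bounded by $$\mathcal{O}\left(\Big(\frac{\Delta_1}{\varepsilon}\Big)^{\frac{1+q}{1-r}}+\Big(\frac{L}{\varepsilon}\Big)^{\frac{1+q}{r}}+\Big(\frac{\sigma}{\varepsilon}\Big)^{\frac{p(1+q)}{q(p-1)}}\right).$$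
   Context: Assumptions. (Lower boundedness) $F\ge F^*>-\infty$ on $\mathbb{R}^d$, and $\Delta_1\ge F(x_1)-F^*$ is a given upper bound on the initialization gap. ($L$-smoothness) $F$ is differentiable and $\|\nabla F(x)-\nabla F(y)\|\le L\|x-y\|$ for all $x,y\in\mathbb{R}^d$, where $L\ge0$. ($p$-BCM) for all $x\in\mathbb{R}^d$: $\mathbb{E}[\nabla f(x,\xi)]=\nabla F(x)$ and $\mathbb{E}[\|\nabla f(x,\xi)-\nabla F(x)\|^p]\le\sigma^p$. minibatch-NSGD: from a deterministic initial point $x_1$, iterate $x_{t+1}=x_t-\eta_t\, g_t/\|g_t\|$ with $g_t=\frac1{B_t}\sum_{j=1}^{B_t}\nabla f(x_t,\xi_t^{(j)})$, where all $\xi_t^{(j)}$ (over all $t$ and $j$) are independent copies of $\xi$. Convention: $g/\|g\|:=0$ if $g=0$. A run with horizon $T$ uses $\sum_{t=1}^T B_t$ oracle calls. The notation $\mathcal{O}(\cdot)$ for the sample complexity means: there is a constant $C$ depending only on $\eta,B,q,r,p$ such that, when $\Delta_1>0$, for all sufficiently small $\varepsilon>0$ (the threshold may depend on $\Delta_1,L,\sigma$ and the algorithm parameters) at most $C$ times the displayed expression oracle calls are needed. *)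

theory Defs
  imports "HOL-Probability.Probability" "HOL-Analysis.Lipschitz"
begin

text \<open>Note that \<open>lipschitz_on\<close> contains the condition \<open>0 \<le> L\<close>.\<close>

definition L_smooth ::
  "real \<Rightarrow> ('a::euclidean_space \<Rightarrow> real) \<Rightarrow> ('a \<Rightarrow> 'a) \<Rightarrow> bool" where
  "L_smooth L F gradF \<longleftrightarrow> (\<forall>x. GDERIV F x :> gradF x) \<and> lipschitz_on L UNIV gradF"

definition lower_bounded_gap ::
  "('a \<Rightarrow> real) \<Rightarrow> real \<Rightarrow> 'a \<Rightarrow> real \<Rightarrow> bool" where
  "lower_bounded_gap F Fstar x1 \<Delta>1 \<longleftrightarrow> (\<forall>x. Fstar \<le> F x) \<and> F x1 - Fstar \<le> \<Delta>1"

text \<open>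
  \<open>D\<close> is the law of \<open>\<xi>\<close>, and \<open>gradf x s\<close> is the oracle answer \<open>\<nabla>f(x, s)\<close>. Joint measurability
  makes the iterates random variables. Integrability is spelled out because the Bochner
  integral of a non-integrable function is \<open>0\<close>.
\<close>

definition p_BCM ::
  "'s measure \<Rightarrow> ('a::euclidean_space \<Rightarrow> 's \<Rightarrow> 'a) \<Rightarrow> ('a \<Rightarrow> 'a) \<Rightarrow> real \<Rightarrow> real \<Rightarrow> bool" where
  "p_BCM D gradf gradF p \<sigma> \<longleftrightarrow>
     prob_space D \<and>
     (\<lambda>(x, s). gradf x s) \<in> borel_measurable (borel \<Otimes>\<^sub>M D) \<and>
     (\<forall>x. integrable D (gradf x) \<and> (\<integral>s. gradf x s \<partial>D) = gradF x \<and>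
          integrable D (\<lambda>s. norm (gradf x s - gradF x) powr p) \<and>
          (\<integral>s. norm (gradf x s - gradF x) powr p \<partial>D) \<le> \<sigma> powr p)"

text \<open>
  The random elements \<open>\<xi> t j\<close> used by a run with horizon \<open>T\<close> and batch sizes \<open>b 1, \<dots>, b T\<close>:
  independent, each with law \<open>D\<close>.
\<close>

definition iid_samples ::
  "'w measure \<Rightarrow> 's measure \<Rightarrow> (nat \<Rightarrow> nat \<Rightarrow> 'w \<Rightarrow> 's) \<Rightarrow> nat \<Rightarrow> (nat \<Rightarrow> nat) \<Rightarrow> bool" where
  "iid_samples M D \<xi> T b \<longleftrightarrow>
     prob_space M \<and>
     prob_space.indep_vars M (\<lambda>_. D) (\<lambda>(t, j). \<xi> t j) (SIGMA t:{1..T}. {1..b t}) \<and>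
     (\<forall>t\<in>{1..T}. \<forall>j\<in>{1..b t}. distr M D (\<xi> t j) = D)"

definition minibatch_grad ::
  "('a::euclidean_space \<Rightarrow> 's \<Rightarrow> 'a) \<Rightarrow> nat \<Rightarrow> (nat \<Rightarrow> 's) \<Rightarrow> 'a \<Rightarrow> 'a" where
  "minibatch_grad gradf n s x = (1 / real n) *\<^sub>R (\<Sum>j=1..n. gradf x (s j))"

text \<open>
  \<open>minibatch_nsgd \<dots> t \<omega>\<close> is \<open>x\<^sub>t\<close>. Time starts at \<open>1\<close>; the value at \<open>0\<close> is a dummy. In a normed
  space \<open>sgn g = g /\<^sub>R norm g\<close>, with \<open>sgn 0 = 0\<close>.
\<close>

primrec minibatch_nsgd ::
  "('a::euclidean_space \<Rightarrow> 's \<Rightarrow> 'a) \<Rightarrow> (nat \<Rightarrow> real) \<Rightarrow> (nat \<Rightarrow> nat) \<Rightarrow>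
   (nat \<Rightarrow> nat \<Rightarrow> 'w \<Rightarrow> 's) \<Rightarrow> 'a \<Rightarrow> nat \<Rightarrow> 'w \<Rightarrow> 'a" where
  "minibatch_nsgd gradf \<eta> b \<xi> x1 0 \<omega> = x1"
| "minibatch_nsgd gradf \<eta> b \<xi> x1 (Suc t) \<omega> =
     (if t = 0 then x1
      else minibatch_nsgd gradf \<eta> b \<xi> x1 t \<omega> -
        \<eta> t *\<^sub>R sgn (minibatch_grad gradf (b t) (\<lambda>j. \<xi> t j \<omega>)
                     (minibatch_nsgd gradf \<eta> b \<xi> x1 t \<omega>)))"

definition oracle_calls :: "(nat \<Rightarrow> nat) \<Rightarrow> nat \<Rightarrow> nat" where
  "oracle_calls b T = (\<Sum>t=1..T. b t)"

definition avg_grad_norm ::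
  "'w measure \<Rightarrow> ('a::euclidean_space \<Rightarrow> 'a) \<Rightarrow> (nat \<Rightarrow> 'w \<Rightarrow> 'a) \<Rightarrow> nat \<Rightarrow> real" where
  "avg_grad_norm M gradF X T =
     1 / real T * (\<Sum>t=1..T. prob_space.expectation M (\<lambda>\<omega>. norm (gradF (X t \<omega>))))"

definition nsgd_step :: "real \<Rightarrow> real \<Rightarrow> nat \<Rightarrow> nat \<Rightarrow> real" where
  "nsgd_step \<eta> r T = (\<lambda>t. \<eta> * real T powr (- r))"

definition nsgd_batch :: "real \<Rightarrow> real \<Rightarrow> nat \<Rightarrow> nat \<Rightarrow> nat" where
  "nsgd_batch B q T = (\<lambda>t. nat \<lceil>max 1 (B * real T powr q)\<rceil>)"

text \<open>
  The constant hidden in the \<open>\<O>\<close>-notation, and the threshold below which the accuracy counts as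
  sufficiently small. An existential quantifier inside a theorem that is polymorphic in the
  Euclidean space and the sample spaces would allow its witness to depend on these types, hence
  on the dimension. Explicit values rule this out: the constant depends only on
  \<open>\<eta>, B, q, r, p\<close>, and the threshold only on \<open>\<Delta>1\<close> and \<open>\<eta>, B, q, r\<close>. They arise from making each of
  the three terms of the convergence bound at most \<open>\<epsilon> / 3\<close>, where the threshold ensures that
  \<open>T \<ge> 1\<close> already before rounding \<open>T\<close> up, and \<open>B * T powr q \<ge> 1\<close>. Neither is optimized.
\<close>

definition complexity_const :: "real \<Rightarrow> real \<Rightarrow> real \<Rightarrow> real \<Rightarrow> real \<Rightarrow> real" where
  "complexity_const \<eta> B q r p =
     2 powr (2 + q) * B *
       ((3 / \<eta>) powr ((1 + q) / (1 - r)) + (3 * \<eta> / 2) powr ((1 + q) / r) +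
        (1 / B) powr ((1 + q) / q) * 12 powr (p * (1 + q) / (q * (p - 1))))"

definition accuracy_threshold :: "real \<Rightarrow> real \<Rightarrow> real \<Rightarrow> real \<Rightarrow> real \<Rightarrow> real" where
  "accuracy_threshold \<eta> B q r \<Delta>1 = 3 * \<Delta>1 / \<eta> * min 1 (B powr ((1 - r) / q))"

end

theory Submission
  imports Defs
begin

text \<open>
  For a normalized step the descent lemma loses only the oracle error, since
  \<open>v \<bullet> sgn g \<ge> norm v - 2 * norm (g - v)\<close>. The expected error of a minibatch of size \<open>n\<close> is at most
  \<open>2 * \<sigma> / n powr ((p - 1) / p)\<close> by a von Bahr--Esseen inequality
  \<open>E (norm S powr p) \<le> 2 * (\<Sum>i. E (norm (X i) powr p))\<close> for sums \<open>S\<close> of independent centred \<open>X i\<close>,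
  which follows by induction from a pointwise expansion of \<open>norm (x + y) powr p\<close> whose linear term
  has mean zero. The descent inequality is summed along each trajectory before taking expectations.
\<close>

section \<open>Real powers and the expansion of \<open>norm (x + y) powr p\<close>\<close>

text \<open>Young's inequality for the conjugate exponents \<open>p / (p - 1)\<close> and
  \<open>p\<close>, cleared of denominators. It serves twice: for the cross term of the expansion
  below, and in place of Jensen's inequality.\<close>

lemma powr_Young:
  fixes a b p :: real
  assumes "1 < p" "0 \<le> a" "0 \<le> b"
  shows "p * (a powr (p - 1) * b) \<le> (p - 1) * a powr p + b powr p"
proof -
  have "a powr (p - 1) * b \<le> (a powr (p - 1)) powr (p / (p - 1)) / (p / (p - 1)) + b powr p / p"
    using assms by (intro Youngs_inequality) (auto simp: field_simps)
  also have "(a powr (p - 1)) powr (p / (p - 1)) = a powr p"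
    using assms by (simp add: powr_powr)
  finally show ?thesis
    using assms by (simp add: field_simps)
qed

text \<open>Concavity of \<open>\<lambda>u. u powr a\<close>: weighted AM-GM for \<open>u\<close>
  and \<open>v\<close>, multiplied by \<open>v powr (a - 1)\<close>, is the tangent inequality at
  \<open>v\<close>.\<close>

lemma powr_le_tangent:
  fixes a u v :: real
  assumes "0 \<le> a" "a \<le> 1" "0 \<le> u" "0 < v"
  shows "u powr a \<le> v powr a + a * v powr (a - 1) * (u - v)"
proof (cases "u = 0")
  case True
  have "v powr (a - 1) * v = v powr a"
    using assms by (simp add: powr_mult_base' powr_diff)
  then have "v powr a + a * v powr (a - 1) * (u - v) = (1 - a) * v powr a"
    using True by (simp add: algebra_simps)
  then show ?thesis
    using True assms by simp
next
  case False
  have "u powr a * v powr (1 - a) \<le> a * u + (1 - a) * v"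
    using False assms by (intro Youngs_inequality_0) auto
  then have "v powr (a - 1) * (u powr a * v powr (1 - a)) \<le> v powr (a - 1) * (a * u + (1 - a) * v)"
    by (intro mult_left_mono) auto
  moreover have "v powr (a - 1) * (u powr a * v powr (1 - a)) = u powr a"
  proof -
    have "v powr (a - 1) * v powr (1 - a) = 1"
      using assms by (simp flip: powr_add)
    then show ?thesis by (simp add: mult_ac)
  qed
  moreover have "v powr (a - 1) * v = v powr a"
    using assms by (simp add: powr_diff)
  then have "v powr (a - 1) * (a * u + (1 - a) * v) = v powr a + a * v powr (a - 1) * (u - v)"
    by (simp add: algebra_simps)
  ultimately show ?thesis by simp
qed

text \<open>The middle term is the derivative of \<open>norm x powr p\<close> in direction
  \<open>y\<close>. The remainder is bounded independently of \<open>x\<close>, as an induction over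
  partial sums requires.\<close>

lemma norm_add_powr_le:
  fixes x y :: "'a::real_inner"
  assumes p: "1 < p" "p \<le> 2"
  shows "norm (x + y) powr p \<le>
    norm x powr p + p * norm x powr (p - 2) * (x \<bullet> y) + 2 * norm y powr p"
proof (cases "x = 0")
  case False
  define a b c where "a = norm x" and "b = norm y" and "c = x \<bullet> y"
  have a: "a > 0" and b: "b \<ge> 0"
    using False by (auto simp: a_def b_def)
  have c: "- (a * b) \<le> c"
    using Cauchy_Schwarz_ineq2[of x y] by (simp add: a_def b_def c_def)
  define u where "u = a\<^sup>2 + 2 * c + b\<^sup>2"
  have "(norm (x + y))\<^sup>2 = u"
    by (simp add: u_def a_def b_def c_def power2_norm_eq_inner inner_add inner_commute)
  then have u: "norm (x + y) powr p = u powr (p / 2)" "u \<ge> 0"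
    using powr_powr[of "norm (x + y)" 2 "p / 2"] by auto
  have square: "(v\<^sup>2) powr (p / 2) = v powr p" "(v\<^sup>2) powr (p / 2 - 1) = v powr (p - 2)"
    if "v \<ge> 0" for v :: real
    using that powr_powr[of v 2 "p / 2"] powr_powr[of v 2 "p / 2 - 1"]
    by (auto simp: algebra_simps)
  \<comment> \<open>As \<open>p / 2 \<le> 1\<close>, \<open>u powr (p / 2)\<close> lies below its tangents. The tangent at \<open>a\<^sup>2\<close> gives an error of order
    \<open>a powr (p - 2) * b\<^sup>2\<close>, which is too large when \<open>a\<close> is small. There the tangent at the smallest
    possible value \<open>(b - a)\<^sup>2\<close> of \<open>u\<close> is used.\<close>
  have "u powr (p / 2) \<le> a powr p + p * a powr (p - 2) * c + 2 * b powr p"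
  proof (cases "b \<le> 2 * a")
    case True
    have "u powr (p / 2) \<le> a powr p + p / 2 * a powr (p - 2) * (2 * c + b\<^sup>2)"
      using powr_le_tangent[of "p / 2" u "a\<^sup>2"] a u p square[of a] by (simp add: u_def)
    moreover have "a powr (p - 2) * b\<^sup>2 \<le> 2 * b powr p"
    proof (cases "b = 0")
      case False
      then have "b > 0" using b by simp
      \<comment> \<open>Here \<open>b / 2 \<le> a\<close>, and the nonpositive exponent
        \<open>p - 2\<close> reverses the order.\<close>
      have "a powr (p - 2) \<le> (b / 2) powr (p - 2)"
        using True \<open>b > 0\<close> p by (intro powr_mono2') auto
      also have "\<dots> = 2 powr (2 - p) * b powr (p - 2)"
        using \<open>b > 0\<close> by (simp add: powr_divide powr_diff)
      also have "\<dots> \<le> 2 * b powr (p - 2)"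
        using powr_mono[of "2 - p" 1 "2 :: real"] p by (intro mult_right_mono) auto
      finally have "a powr (p - 2) * b\<^sup>2 \<le> 2 * b powr (p - 2) * b\<^sup>2"
        by (intro mult_right_mono) auto
      also have "\<dots> = 2 * b powr p"
        using \<open>b > 0\<close> by (simp add: powr_diff)
      finally show ?thesis .
    qed simp
    then have "p / 2 * (a powr (p - 2) * b\<^sup>2) \<le> 1 * (2 * b powr p)"
      using p by (intro mult_mono[of "p / 2" 1]) auto
    ultimately show ?thesis
      by (simp add: field_simps)
  next
    case False
    define d where "d = b - a"
    \<comment> \<open>The factor 2 in the case condition is chosen so that its failure gives
      \<open>d \<ge> a\<close>.\<close>
    have d: "d \<ge> a" "d > 0" "d \<le> b" using False a b by (auto simp: d_def)
    have "u powr (p / 2) \<le> d powr p + p / 2 * d powr (p - 2) * (2 * (c + a * b))"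
    proof -
      have "u - d\<^sup>2 = 2 * (c + a * b)"
        by (simp add: u_def d_def power2_eq_square algebra_simps)
      then show ?thesis
        using powr_le_tangent[of "p / 2" u "d\<^sup>2"] d u p square[of d] by simp
    qed
    \<comment> \<open>As \<open>c + a * b\<close> is nonnegative by Cauchy-Schwarz and
      \<open>p - 2 \<le> 0\<close>, replacing \<open>d\<close> by the smaller \<open>a\<close>
      enlarges the bound and produces the required linear coefficient.\<close>
    also have "p / 2 * d powr (p - 2) * (2 * (c + a * b)) \<le> p / 2 * a powr (p - 2) * (2 * (c + a * b))"
      using d a c p by (intro mult_right_mono mult_left_mono powr_mono2') auto
    also have "\<dots> = p * a powr (p - 2) * c + p * (a powr (p - 1) * b)"
      using a by (simp add: field_simps powr_diff power2_eq_square)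
    \<comment> \<open>One \<open>b powr p\<close> arises here and another from
      \<open>d powr p\<close>, which accounts for the constant 2; the remaining
      \<open>(p - 1) * a powr p\<close> is absorbed because \<open>p \<le> 2\<close>.\<close>
    also have "p * (a powr (p - 1) * b) \<le> (p - 1) * a powr p + b powr p"
      using a b p by (intro powr_Young) auto
    also have "d powr p \<le> b powr p"
      using d p by (intro powr_mono2) auto
    also have "(p - 1) * a powr p \<le> 1 * a powr p"
      using p by (intro mult_right_mono) auto
    finally show ?thesis by simp
  qed
  then show ?thesis
    unfolding u(1) by (simp add: a_def b_def c_def)
qed (use p in auto)

section \<open>Moments of sums of independent centred vectors\<close>

text \<open>Independence is encoded by the product measure, so that the induction can split off one
  coordinate by Tonelli. Nonnegative integrals spare the induction any integrability of the partial
  sums.\<close>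

lemma nn_integral_norm_sum_powr_le:
  fixes h :: "'s \<Rightarrow> 'a::euclidean_space"
  assumes p: "1 < p" "p \<le> 2" and "prob_space D"
    and h: "integrable D h" "(\<integral>s. h s \<partial>D) = 0"
    and hp: "integrable D (\<lambda>s. norm (h s) powr p)" "(\<integral>s. norm (h s) powr p \<partial>D) \<le> v"
    and "finite I"
  shows "(\<integral>\<^sup>+w. ennreal (norm (\<Sum>i\<in>I. h (w i)) powr p) \<partial>(\<Pi>\<^sub>M i\<in>I. D)) \<le> ennreal (2 * real (card I) * v)"
  using \<open>finite I\<close>
proof induction
  case empty
  then show ?case using p by simp
next
  case (insert k I)
  interpret D: prob_space D by fact
  interpret product_sigma_finite "\<lambda>_. D" ..
  interpret P: prob_space "PiM I (\<lambda>_. D)" by (intro prob_space_PiM assms)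
  note [measurable] = borel_measurable_integrable[OF h(1)]
  have v: "0 \<le> v" using hp(2) by (rule order_trans[rotated]) simp
  \<comment> \<open>\<open>S\<close> stands for the partial sum over the other coordinates, which is
    constant while the new one is integrated.\<close>
  have step: "(\<integral>\<^sup>+s. ennreal (norm (h s + S) powr p) \<partial>D) \<le> ennreal (norm S powr p) + ennreal (2 * v)" for S
  proof -
    let ?g = "\<lambda>s. norm S powr p + p * norm S powr (p - 2) * (S \<bullet> h s) + 2 * norm (h s) powr p"
    have le: "norm (h s + S) powr p \<le> ?g s" for s
      using norm_add_powr_le[OF p, of S "h s"] by (simp add: add.commute)
    have g: "integrable D ?g"
      using h hp by (intro Bochner_Integration.integrable_add integrable_mult_right integrable_inner_right) auto
    have "(\<integral>\<^sup>+s. ennreal (norm (h s + S) powr p) \<partial>D) \<le> (\<integral>\<^sup>+s. ennreal (?g s) \<partial>D)"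
      by (intro nn_integral_mono ennreal_leI le)
    \<comment> \<open>The linear part of \<open>?g\<close> can be negative, but \<open>?g\<close>
      dominates a nonnegative function. Hence the Bochner integral may be used, and there the linear
      part vanishes.\<close>
    also have "\<dots> = ennreal (\<integral>s. ?g s \<partial>D)"
      by (intro nn_integral_eq_integral g AE_I2 order_trans[OF _ le]) simp
    also have "(\<integral>s. ?g s \<partial>D) = norm S powr p + 2 * (\<integral>s. norm (h s) powr p \<partial>D)"
      using h hp by (simp add: D.prob_space)
    also have "ennreal \<dots> \<le> ennreal (norm S powr p + 2 * v)"
      using hp(2) by (intro ennreal_leI) simp
    finally show ?thesis using v by (simp add: ennreal_plus)
  qed
  have "(\<integral>\<^sup>+w. ennreal (norm (\<Sum>i\<in>insert k I. h (w i)) powr p) \<partial>(\<Pi>\<^sub>M i\<in>insert k I. D)) =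
    (\<integral>\<^sup>+w. \<integral>\<^sup>+s. ennreal (norm (\<Sum>i\<in>insert k I. h ((w(k := s)) i)) powr p) \<partial>D \<partial>(\<Pi>\<^sub>M i\<in>I. D))"
    using insert by (intro product_nn_integral_insert) measurable
  also have "\<dots> = (\<integral>\<^sup>+w. \<integral>\<^sup>+s. ennreal (norm (h s + (\<Sum>i\<in>I. h (w i))) powr p) \<partial>D \<partial>(\<Pi>\<^sub>M i\<in>I. D))"
  proof -
    have "(\<Sum>i\<in>I. h ((w(k := s)) i)) = (\<Sum>i\<in>I. h (w i))" for w s
      using insert by (intro sum.cong) auto
    then show ?thesis using insert by simp
  qed
  also have "\<dots> \<le> (\<integral>\<^sup>+w. ennreal (norm (\<Sum>i\<in>I. h (w i)) powr p) + ennreal (2 * v) \<partial>(\<Pi>\<^sub>M i\<in>I. D))"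
    by (intro nn_integral_mono step)
  also have "\<dots> = (\<integral>\<^sup>+w. ennreal (norm (\<Sum>i\<in>I. h (w i)) powr p) \<partial>(\<Pi>\<^sub>M i\<in>I. D)) + ennreal (2 * v)"
    by (subst nn_integral_add) (auto simp: P.emeasure_space_1)
  also have "\<dots> \<le> ennreal (2 * real (card I) * v) + ennreal (2 * v)"
    by (intro add_right_mono insert)
  also have "\<dots> = ennreal (2 * real (card (insert k I)) * v)"
    using v insert by (simp add: algebra_simps flip: ennreal_plus)
  finally show ?case .
qed

text \<open>Jensen's inequality, obtained by integrating Young's inequality between
  \<open>f x\<close> and a constant \<open>k\<close>; the choice \<open>k = m\<close> would make it
  sharp.\<close>

lemma (in prob_space) nn_integral_le_of_powr:
  fixes f :: "'a \<Rightarrow> real"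
  assumes p: "1 < p" and f: "f \<in> borel_measurable M" "\<And>x. 0 \<le> f x" and "0 \<le> m"
    and le: "(\<integral>\<^sup>+x. ennreal (f x powr p) \<partial>M) \<le> ennreal (m powr p)"
  shows "(\<integral>\<^sup>+x. ennreal (f x) \<partial>M) \<le> ennreal m"
proof (rule ennreal_le_epsilon)
  fix e :: real assume "0 < e"
  \<comment> \<open>Since \<open>m\<close> may be 0, it is enlarged by \<open>e\<close> to make the
    factor \<open>c\<close> positive and cancellable.\<close>
  define k where "k = m + e"
  have k: "k > 0" using \<open>0 \<le> m\<close> \<open>0 < e\<close> by (simp add: k_def)
  define c where "c = p * k powr (p - 1)"
  have c: "c > 0" using p k by (simp add: c_def)
  note [measurable] = f(1)
  have "ennreal c * (\<integral>\<^sup>+x. ennreal (f x) \<partial>M) = (\<integral>\<^sup>+x. ennreal (c * f x) \<partial>M)"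
    using c f by (subst nn_integral_cmult[symmetric]) (auto simp: ennreal_mult)
  also have "\<dots> \<le> (\<integral>\<^sup>+x. ennreal ((p - 1) * k powr p) + ennreal (f x powr p) \<partial>M)"
    using powr_Young[OF p _ f(2), of k] k p
    by (intro nn_integral_mono) (auto simp: c_def mult_ac simp flip: ennreal_plus intro!: ennreal_leI)
  also have "\<dots> = ennreal ((p - 1) * k powr p) + (\<integral>\<^sup>+x. ennreal (f x powr p) \<partial>M)"
    by (subst nn_integral_add) (auto simp: emeasure_space_1)
  also have "\<dots> \<le> ennreal ((p - 1) * k powr p) + ennreal (k powr p)"
    using \<open>0 \<le> m\<close> \<open>0 < e\<close> p
    by (intro add_left_mono order_trans[OF le] ennreal_leI powr_mono2) (auto simp: k_def)
  also have "\<dots> = ennreal (c * k)"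
    using p k by (simp add: c_def powr_diff algebra_simps flip: ennreal_plus)
  also have "\<dots> = ennreal c * ennreal k"
    using c k by (simp add: ennreal_mult)
  finally have "(\<integral>\<^sup>+x. ennreal (f x) \<partial>M) \<le> ennreal k"
    using c by (simp add: ennreal_mult_le_mult_iff)
  then show "(\<integral>\<^sup>+x. ennreal (f x) \<partial>M) \<le> ennreal m + ennreal e"
    using \<open>0 \<le> m\<close> \<open>0 < e\<close> by (simp add: k_def)
qed

section \<open>Descent along a normalized step\<close>

text \<open>Instead of integrating the gradient along the segment, \<open>?\<phi>\<close> subtracts
  the linear and quadratic terms of the model from \<open>F\<close>. By Cauchy-Schwarz and the
  Lipschitz bound its derivative is nonpositive, so its endpoint values compare as claimed.\<close>

lemma L_smooth_descent:
  fixes F :: "'a::euclidean_space \<Rightarrow> real"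
  assumes "L_smooth L F gradF"
  shows "F (x + d) \<le> F x + gradF x \<bullet> d + L / 2 * (norm d)\<^sup>2"
proof -
  let ?\<phi> = "\<lambda>s. F (x + s *\<^sub>R d) - s * (gradF x \<bullet> d) - L * s\<^sup>2 / 2 * (norm d)\<^sup>2"
  have F: "(F has_derivative (\<lambda>h. h \<bullet> gradF z)) (at z)" for z
    using assms by (simp add: L_smooth_def gderiv_def)
  have lip: "norm (gradF y - gradF z) \<le> L * norm (y - z)" for y z
    using assms by (auto simp: L_smooth_def lipschitz_on_def dist_norm)
  have "?\<phi> 1 \<le> ?\<phi> 0"
  proof (rule DERIV_nonpos_imp_nonincreasing[of 0 1 ?\<phi>])
    fix s :: real assume s: "0 \<le> s"
    let ?D = "d \<bullet> gradF (x + s *\<^sub>R d) - gradF x \<bullet> d - L * s * (norm d)\<^sup>2"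
    have "((\<lambda>s. F (x + s *\<^sub>R d)) has_derivative (\<lambda>h. (h *\<^sub>R d) \<bullet> gradF (x + s *\<^sub>R d))) (at s)"
      by (rule has_derivative_compose[of "\<lambda>s. x + s *\<^sub>R d" "\<lambda>h. h *\<^sub>R d", OF _ F])
        (auto intro!: derivative_eq_intros)
    then have "((\<lambda>s. F (x + s *\<^sub>R d)) has_real_derivative d \<bullet> gradF (x + s *\<^sub>R d)) (at s)"
      by (simp add: has_field_derivative_def mult.commute[of _ "d \<bullet> _"])
    then have "(?\<phi> has_real_derivative ?D) (at s)"
      by (auto intro!: derivative_eq_intros simp: algebra_simps)
    moreover have "d \<bullet> (gradF (x + s *\<^sub>R d) - gradF x) \<le> norm d * (L * norm (s *\<^sub>R d))"
      using lip[of "x + s *\<^sub>R d" x]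
      by (intro order_trans[OF norm_cauchy_schwarz] mult_left_mono) auto
    then have "?D \<le> 0"
      using s by (simp add: inner_diff_right inner_commute power2_eq_square algebra_simps)
    ultimately show "\<exists>D. (?\<phi> has_real_derivative D) (at s) \<and> D \<le> 0" by blast
  qed simp
  then show ?thesis by simp
qed

text \<open>Write \<open>v = g - (g - v)\<close>. Pairing with \<open>sgn g\<close> yields
  \<open>norm g\<close> minus at most \<open>norm (g - v)\<close>, and replacing
  \<open>norm g\<close> by \<open>norm v\<close> costs the same amount again. The argument covers
  \<open>g = 0\<close>.\<close>

lemma inner_sgn_ge:
  fixes g v :: "'a::real_inner"
  shows "v \<bullet> sgn g \<ge> norm v - 2 * norm (g - v)"
proof -
  have "g \<bullet> sgn g = norm g"
    by (cases "g = 0") (simp_all add: sgn_div_norm power2_norm_eq_inner[symmetric] power2_eq_square)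
  moreover have "norm (sgn g) \<le> 1"
    by (simp add: norm_sgn)
  then have "(g - v) \<bullet> sgn g \<le> norm (g - v)"
    using norm_cauchy_schwarz[of "g - v" "sgn g"] mult_left_mono[of "norm (sgn g)" 1 "norm (g - v)"]
    by simp
  moreover have "norm v \<le> norm g + norm (g - v)"
    using norm_triangle_ineq4[of g "g - v"] by simp
  ultimately show ?thesis by (simp add: inner_diff_left)
qed

section \<open>Measurability of the iterates and their dependence on past samples\<close>

text \<open>The space \<open>N\<close> is arbitrary because two are needed: the underlying
  probability space, and the product space of past samples with its coordinates as
  \<open>\<xi>\<close>.\<close>

lemma borel_measurable_minibatch_nsgd:
  fixes gradf :: "'a::euclidean_space \<Rightarrow> 's \<Rightarrow> 'a"
  assumes [measurable]: "(\<lambda>(x, s). gradf x s) \<in> borel_measurable (borel \<Otimes>\<^sub>M D)"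
    and "\<And>s j. s \<in> {1..<t} \<Longrightarrow> j \<in> {1..b s} \<Longrightarrow> \<xi> s j \<in> measurable N D"
  shows "minibatch_nsgd gradf \<eta> b \<xi> x1 t \<in> borel_measurable N"
  using assms(2)
proof (induction t)
  case 0
  have "minibatch_nsgd gradf \<eta> b \<xi> x1 0 = (\<lambda>_. x1)"
    by (rule ext) simp
  then show ?case by simp
next
  case (Suc t)
  let ?X = "minibatch_nsgd gradf \<eta> b \<xi> x1"
  show ?case
  proof (cases "t = 0")
    case True
    then have "?X (Suc t) = (\<lambda>_. x1)"
      by (intro ext) simp
    then show ?thesis by (metis measurable_const space_borel UNIV_I)
  next
    case False
    have [measurable]: "?X t \<in> borel_measurable N"
      using Suc by simp
    have [measurable]: "\<xi> t j \<in> measurable N D" if "j \<in> {1..b t}" for j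
      using Suc.prems that False by simp
    have [measurable]: "(\<lambda>\<omega>. minibatch_grad gradf (b t) (\<lambda>j. \<xi> t j \<omega>) (?X t \<omega>)) \<in> borel_measurable N"
      unfolding minibatch_grad_def by measurable
    have X: "?X (Suc t) = (\<lambda>\<omega>. ?X t \<omega> - \<eta> t *\<^sub>R sgn (minibatch_grad gradf (b t) (\<lambda>j. \<xi> t j \<omega>) (?X t \<omega>)))"
      using False by (intro ext) simp
    show ?thesis unfolding X by measurable
  qed
qed

text \<open>The iterate at time \<open>t\<close> is determined by the samples of earlier rounds. The
  two sample spaces may differ, so the recursion can be transported to a product space.\<close>

lemma minibatch_nsgd_cong:
  assumes "\<And>s j. s \<in> {1..<t} \<Longrightarrow> j \<in> {1..b s} \<Longrightarrow> \<xi> s j \<omega> = \<xi>' s j \<omega>'"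
  shows "minibatch_nsgd gradf \<eta> b \<xi> x1 t \<omega> = minibatch_nsgd gradf \<eta> b \<xi>' x1 t \<omega>'"
  using assms
proof (induction t)
  case (Suc t)
  show ?case
  proof (cases "t = 0")
    case False
    have "minibatch_grad gradf (b t) (\<lambda>j. \<xi> t j \<omega>) = minibatch_grad gradf (b t) (\<lambda>j. \<xi>' t j \<omega>')"
      unfolding minibatch_grad_def using Suc.prems False
      by (intro ext arg_cong2[where f=scaleR] refl sum.cong) auto
    moreover have "minibatch_nsgd gradf \<eta> b \<xi> x1 t \<omega> = minibatch_nsgd gradf \<eta> b \<xi>' x1 t \<omega>'"
      using Suc by simp
    ultimately show ?thesis by simp
  qed simp
qed simp

section \<open>Expected error of the minibatch gradient\<close>

lemma minibatch_grad_eq_sum: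
  "minibatch_grad gradf n (\<lambda>j. w (t, j)) x =
    (1 / real n) *\<^sub>R (\<Sum>i\<in>{t} \<times> {1..n}. gradf x (w i))"
  unfolding minibatch_grad_def
  by (subst sum.cartesian_product'[of _ "{t}" "{1..n}"]) simp

text \<open>At a fixed point \<open>x\<close> the error is the mean of \<open>n\<close> independent
  centred vectors, so its \<open>p\<close>-th moment is at most
  \<open>2 * \<sigma> powr p / n powr (p - 1)\<close>; Jensen then gives the first moment. Indexing
  by pairs \<open>(t, j)\<close> matches the batch of round \<open>t\<close> within the family of
  all samples.\<close>

lemma nn_integral_minibatch_error_le:
  fixes gradf :: "'a::euclidean_space \<Rightarrow> 's \<Rightarrow> 'a"
  assumes bcm: "p_BCM D gradf gradF p \<sigma>" and p: "1 < p" "p \<le> 2" and "0 \<le> \<sigma>" and n: "1 \<le> n"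
  shows "(\<integral>\<^sup>+w. ennreal (norm (minibatch_grad gradf n (\<lambda>j. w (t, j)) x - gradF x))
      \<partial>(\<Pi>\<^sub>M i\<in>{t} \<times> {1..n}. D)) \<le> ennreal (2 * \<sigma> / real n powr ((p - 1) / p))"
proof -
  have D: "prob_space D"
    and gradf: "integrable D (gradf x)" "(\<integral>s. gradf x s \<partial>D) = gradF x"
      "integrable D (\<lambda>s. norm (gradf x s - gradF x) powr p)"
      "(\<integral>s. norm (gradf x s - gradF x) powr p \<partial>D) \<le> \<sigma> powr p"
    using bcm by (auto simp: p_BCM_def)
  let ?I = "{t} \<times> {1..n}"
  let ?h = "\<lambda>s. gradf x s - gradF x"
  let ?e = "\<lambda>w. norm (minibatch_grad gradf n (\<lambda>j. w (t, j)) x - gradF x)"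
  interpret D: prob_space D by fact
  interpret P: prob_space "PiM ?I (\<lambda>_. D)" by (intro prob_space_PiM D)
  have [measurable]: "gradf x \<in> borel_measurable D"
    using gradf by auto
  have e_eq: "?e w = norm (\<Sum>i\<in>?I. ?h (w i)) / real n" for w
  proof -
    have "minibatch_grad gradf n (\<lambda>j. w (t, j)) x - gradF x = (1 / real n) *\<^sub>R (\<Sum>i\<in>?I. ?h (w i))"
      unfolding minibatch_grad_eq_sum sum_subtractf scaleR_diff_right sum_constant_scaleR
      using n by (simp add: card_cartesian_product)
    then show ?thesis by simp
  qed
  have sum: "(\<integral>\<^sup>+w. ennreal (norm (\<Sum>i\<in>?I. ?h (w i)) powr p) \<partial>(\<Pi>\<^sub>M i\<in>?I. D))
      \<le> ennreal (2 * real (card ?I) * \<sigma> powr p)"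
    using gradf p D by (intro nn_integral_norm_sum_powr_le) (auto simp: D.prob_space)
  define m where "m = 2 * \<sigma> / real n powr ((p - 1) / p)"
  have "(\<integral>\<^sup>+w. ennreal (?e w powr p) \<partial>(\<Pi>\<^sub>M i\<in>?I. D)) =
      (\<integral>\<^sup>+w. ennreal (1 / real n powr p) * ennreal (norm (\<Sum>i\<in>?I. ?h (w i)) powr p) \<partial>(\<Pi>\<^sub>M i\<in>?I. D))"
    unfolding e_eq by (intro nn_integral_cong) (simp add: powr_divide flip: ennreal_mult')
  also have "\<dots> = ennreal (1 / real n powr p) *
      (\<integral>\<^sup>+w. ennreal (norm (\<Sum>i\<in>?I. ?h (w i)) powr p) \<partial>(\<Pi>\<^sub>M i\<in>?I. D))"
    by (intro nn_integral_cmult) measurable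
  also have "\<dots> \<le> ennreal (1 / real n powr p) * ennreal (2 * real (card ?I) * \<sigma> powr p)"
    by (intro mult_left_mono sum) simp
  also have "\<dots> = ennreal (1 / real n powr p * (2 * real n * \<sigma> powr p))"
    by (subst ennreal_mult[symmetric]) (simp_all add: card_cartesian_product)
  also have "\<dots> \<le> ennreal (m powr p)"
  proof (rule ennreal_leI)
    have "1 / real n powr p * (2 * real n * \<sigma> powr p) = 2 * (\<sigma> powr p / real n powr (p - 1))"
      using n by (simp add: powr_diff)
    \<comment> \<open>Relaxing 2 to \<open>2 powr p\<close> makes the constant after the
      \<open>p\<close>-th root simply 2.\<close>
    also have "\<dots> \<le> 2 powr p * (\<sigma> powr p / real n powr (p - 1))"
      using powr_mono[of 1 p "2 :: real"] p by (intro mult_right_mono) auto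
    also have "\<dots> = m powr p"
      using p \<open>0 \<le> \<sigma>\<close> by (simp add: m_def powr_divide powr_mult powr_powr)
    finally show "1 / real n powr p * (2 * real n * \<sigma> powr p) \<le> m powr p" .
  qed
  finally have moment: "(\<integral>\<^sup>+w. ennreal (?e w powr p) \<partial>(\<Pi>\<^sub>M i\<in>?I. D)) \<le> ennreal (m powr p)" .
  have "?e \<in> borel_measurable (\<Pi>\<^sub>M i\<in>?I. D)"
    unfolding e_eq by measurable
  then show ?thesis
    unfolding m_def[symmetric]
  proof (rule P.nn_integral_le_of_powr[OF p(1) _ _ _ moment])
    show "0 \<le> m" using \<open>0 \<le> \<sigma>\<close> by (simp add: m_def)
  qed simp
qed

lemma nn_integral_nsgd_error_le:
  fixes gradf :: "'a::euclidean_space \<Rightarrow> 's \<Rightarrow> 'a"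
  assumes bcm: "p_BCM D gradf gradF p \<sigma>" and p: "1 < p" "p \<le> 2" and "0 \<le> \<sigma>"
    and [measurable]: "gradF \<in> borel_measurable borel"
    and iid: "iid_samples M D \<xi> T b" and t: "t \<in> {1..T}" and "1 \<le> b t"
  shows "(\<integral>\<^sup>+\<omega>. ennreal (norm (minibatch_grad gradf (b t) (\<lambda>j. \<xi> t j \<omega>)
      (minibatch_nsgd gradf \<eta> b \<xi> x1 t \<omega>) - gradF (minibatch_nsgd gradf \<eta> b \<xi> x1 t \<omega>))) \<partial>M)
    \<le> ennreal (2 * \<sigma> / real (b t) powr ((p - 1) / p))"
proof -
  have "prob_space M" "prob_space D"
    and [measurable]: "(\<lambda>(x, s). gradf x s) \<in> borel_measurable (borel \<Otimes>\<^sub>M D)"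
    using iid bcm by (auto simp: iid_samples_def p_BCM_def)
  interpret M: prob_space M by fact
  \<comment> \<open>The iterate \<open>x\<^sub>t\<close> is a function of the samples indexed by \<open>A\<close>, which are independent of the batch
    indexed by \<open>C\<close>, so the error can be bounded with \<open>x\<^sub>t\<close> frozen.\<close>
  define A where "A = (SIGMA s:{1..<t}. {1..b s})"
  define C where "C = {t} \<times> {1..b t}"
  let ?K = "SIGMA s:{1..T}. {1..b s}"
  let ?\<xi> = "\<lambda>(s, j). \<xi> s j"
  have indep: "M.indep_vars (\<lambda>_. D) ?\<xi> ?K"
    and law: "\<And>s j. s \<in> {1..T} \<Longrightarrow> j \<in> {1..b s} \<Longrightarrow> distr M D (\<xi> s j) = D"
    using iid by (auto simp: iid_samples_def)
  have sub: "A \<inter> C = {}" "A \<subseteq> ?K" "C \<subseteq> ?K" and C: "C \<noteq> {}"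
    using t \<open>1 \<le> b t\<close> by (auto simp: A_def C_def)
  define RA where "RA = (\<lambda>\<omega>. restrict (\<lambda>i. ?\<xi> i \<omega>) A)"
  define RC where "RC = (\<lambda>\<omega>. restrict (\<lambda>i. ?\<xi> i \<omega>) C)"
  let ?PA = "PiM A (\<lambda>_. D)" and ?PC = "PiM C (\<lambda>_. D)"
  have "M.indep_var ?PA RA ?PC RC"
    unfolding RA_def RC_def by (rule M.indep_var_restrict[OF indep sub])
  then have [measurable]: "RA \<in> measurable M ?PA" "RC \<in> measurable M ?PC"
    and joint: "distr M ?PA RA \<Otimes>\<^sub>M distr M ?PC RC = distr M (?PA \<Otimes>\<^sub>M ?PC) (\<lambda>\<omega>. (RA \<omega>, RC \<omega>))"
    by (auto simp: M.indep_var_distribution_eq)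
  \<comment> \<open>Independence within the nonempty batch and the common law \<open>D\<close>
    identify the joint law of the batch with the product measure used in the bound at a fixed
    point.\<close>
  have "M.indep_vars (\<lambda>_. D) ?\<xi> C"
    using indep sub(3) by (rule M.indep_vars_subset)
  moreover have "?\<xi> i \<in> measurable M D" if "i \<in> C" for i
    using calculation that by (auto simp: M.indep_vars_def)
  ultimately have "distr M ?PC RC = PiM C (\<lambda>i. distr M D (?\<xi> i))"
    unfolding RC_def using C by (subst (asm) M.indep_vars_iff_distr_eq_PiM') auto
  also have "\<dots> = ?PC"
    using law t by (intro PiM_cong) (auto simp: C_def)
  finally have RC: "distr M ?PC RC = ?PC" .
  \<comment> \<open>\<open>Y\<close> runs the same recursion on the product space of past samples,
    with the coordinate projections as samples.\<close>
  define Y where "Y = minibatch_nsgd gradf \<eta> b (\<lambda>s j w. w (s, j)) x1 t"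
  have Y[measurable]: "Y \<in> borel_measurable ?PA"
    unfolding Y_def
    by (rule borel_measurable_minibatch_nsgd[of _ D]) (auto simp: A_def intro!: measurable_component_singleton)
  have Y_RA: "minibatch_nsgd gradf \<eta> b \<xi> x1 t \<omega> = Y (RA \<omega>)" for \<omega>
    unfolding Y_def by (rule minibatch_nsgd_cong) (auto simp: RA_def A_def)
  have grad_RC: "minibatch_grad gradf (b t) (\<lambda>j. \<xi> t j \<omega>) x =
      minibatch_grad gradf (b t) (\<lambda>j. RC \<omega> (t, j)) x" for x \<omega>
    unfolding minibatch_grad_def
    by (intro arg_cong2[where f=scaleR] refl sum.cong) (auto simp: RC_def C_def)
  let ?e = "\<lambda>(a, c). ennreal (norm (minibatch_grad gradf (b t) (\<lambda>j. c (t, j)) (Y a) - gradF (Y a)))"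
  have e: "?e \<in> borel_measurable (?PA \<Otimes>\<^sub>M ?PC)"
  proof -
    have [measurable]: "(\<lambda>x. snd x (t, j)) \<in> measurable (?PA \<Otimes>\<^sub>M ?PC) D" if "j \<in> {1..b t}" for j
      using that by (intro measurable_compose[OF measurable_snd measurable_component_singleton]) (auto simp: C_def)
    show ?thesis
      unfolding minibatch_grad_def split_beta by measurable
  qed
  interpret PC: prob_space ?PC by (intro prob_space_PiM \<open>prob_space D\<close>)
  have PA: "prob_space (distr M ?PA RA)" by (intro M.prob_space_distr) measurable
  \<comment> \<open>The joint law of past and batch is a product, so after a change of variables
    Tonelli makes the batch the inner integral, with the past fixed.\<close>
  have "(\<integral>\<^sup>+\<omega>. ?e (RA \<omega>, RC \<omega>) \<partial>M) = integral\<^sup>N (distr M ?PA RA \<Otimes>\<^sub>M ?PC) ?e"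
    unfolding joint[unfolded RC]
  proof (rule nn_integral_distr[symmetric])
    show "(\<lambda>\<omega>. (RA \<omega>, RC \<omega>)) \<in> measurable M (?PA \<Otimes>\<^sub>M ?PC)" by measurable
  qed (use e in simp)
  also have "\<dots> = (\<integral>\<^sup>+a. \<integral>\<^sup>+c. ?e (a, c) \<partial>?PC \<partial>distr M ?PA RA)"
  proof (rule PC.nn_integral_fst[symmetric])
    have "sets (distr M ?PA RA \<Otimes>\<^sub>M ?PC) = sets (?PA \<Otimes>\<^sub>M ?PC)"
      by (intro sets_pair_measure_cong) simp_all
    then show "?e \<in> borel_measurable (distr M ?PA RA \<Otimes>\<^sub>M ?PC)"
      using e measurable_cong_sets by blast
  qed
  also have "\<dots> \<le> (\<integral>\<^sup>+a. ennreal (2 * \<sigma> / real (b t) powr ((p - 1) / p)) \<partial>distr M ?PA RA)"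
    unfolding C_def split_conv
    by (intro nn_integral_mono nn_integral_minibatch_error_le[OF bcm p \<open>0 \<le> \<sigma>\<close> \<open>1 \<le> b t\<close>])
  also have "\<dots> = ennreal (2 * \<sigma> / real (b t) powr ((p - 1) / p))"
    using prob_space.emeasure_space_1[OF PA] by simp
  finally show ?thesis
    unfolding Y_RA grad_RC split_conv .
qed

section \<open>Convergence for a constant step size and batch size\<close>

text \<open>A normalized step has length at most \<open>h\<close> whatever the oracle answers. This
  deterministic bound later makes the gradient norms bounded, hence integrable.\<close>

lemma norm_minibatch_nsgd_diff_le:
  assumes "0 \<le> h"
  shows "norm (minibatch_nsgd gradf (\<lambda>_. h) b \<xi> x1 t \<omega> - x1) \<le> real t * h"
proof (induction t)
  case (Suc t)
  let ?X = "\<lambda>t. minibatch_nsgd gradf (\<lambda>_. h) b \<xi> x1 t \<omega>"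
  let ?g = "minibatch_grad gradf (b t) (\<lambda>j. \<xi> t j \<omega>) (?X t)"
  show ?case
  proof (cases "t = 0")
    case False
    have "norm (?X (Suc t) - x1) = norm ((?X t - x1) - h *\<^sub>R sgn ?g)"
      using False by (simp add: algebra_simps)
    also have "\<dots> \<le> norm (?X t - x1) + norm (h *\<^sub>R sgn ?g)"
      by (rule norm_triangle_ineq4)
    also have "norm (h *\<^sub>R sgn ?g) \<le> h"
      using assms by (simp add: norm_sgn)
    finally show ?thesis
      using Suc by (simp add: algebra_simps)
  qed (use assms in simp)
qed simp

text \<open>Telescoping at a fixed \<open>\<omega>\<close> leaves only the last value of
  \<open>F\<close>, which the lower bound controls pointwise. Thus no integrability of
  \<open>F\<close> along the iterates is required.\<close>

lemma nsgd_sum_grad_norm_le: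
  fixes gradf :: "'a::euclidean_space \<Rightarrow> 's \<Rightarrow> 'a" and b and \<xi> :: "nat \<Rightarrow> nat \<Rightarrow> 'w \<Rightarrow> 's" and x1
  assumes smooth: "L_smooth L F gradF" and "0 \<le> L" and "0 < h"
  defines "X \<equiv> \<lambda>\<omega> t. minibatch_nsgd gradf (\<lambda>_. h) b \<xi> x1 t \<omega>"
  shows "h * (\<Sum>t=1..T. norm (gradF (X \<omega> t))) \<le> F x1 - F (X \<omega> (Suc T)) + real T * (h\<^sup>2 * L / 2) +
    2 * h * (\<Sum>t=1..T. norm (minibatch_grad gradf (b t) (\<lambda>j. \<xi> t j \<omega>) (X \<omega> t) - gradF (X \<omega> t)))"
proof (induction T)
  case 0
  \<comment> \<open>Time starts at 1, so \<open>X \<omega> (Suc 0)\<close> is \<open>x1\<close> and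
    both sides are 0.\<close>
  then show ?case by (simp add: X_def)
next
  case (Suc T)
  define x where "x = X \<omega> (Suc T)"
  define g where "g = minibatch_grad gradf (b (Suc T)) (\<lambda>j. \<xi> (Suc T) j \<omega>) x"
  have step: "X \<omega> (Suc (Suc T)) = x + (- (h *\<^sub>R sgn g))"
    unfolding X_def x_def g_def by (subst minibatch_nsgd.simps(2)) simp
  have "(norm (sgn g))\<^sup>2 \<le> 1"
    by (simp add: norm_sgn)
  then have "L / 2 * (h\<^sup>2 * (norm (sgn g))\<^sup>2) \<le> L / 2 * (h\<^sup>2 * 1)"
    using \<open>0 \<le> L\<close> by (intro mult_left_mono) auto
  moreover have "h * (norm (gradF x) - 2 * norm (g - gradF x)) \<le> h * (gradF x \<bullet> sgn g)"
    using inner_sgn_ge[of "gradF x" g] \<open>0 < h\<close> by (intro mult_left_mono) auto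
  ultimately have "h * norm (gradF x) \<le> F x - F (X \<omega> (Suc (Suc T))) + h\<^sup>2 * L / 2 + 2 * h * norm (g - gradF x)"
    using L_smooth_descent[OF smooth, of x "- (h *\<^sub>R sgn g)"]
    by (simp add: step power_mult_distrib algebra_simps)
  then show ?case
    using Suc.IH by (simp add: x_def[symmetric] g_def[symmetric] field_simps)
qed

text \<open>The pathwise inequality is integrated, each error expectation is replaced by its bound,
  and the result is divided by \<open>h * T\<close>.\<close>

lemma nsgd_convergence:
  fixes gradf :: "'a::euclidean_space \<Rightarrow> 's \<Rightarrow> 'a"
  assumes p: "1 < p" "p \<le> 2" and nonneg: "0 \<le> \<sigma>" "0 \<le> L" and h: "0 < h" and n: "1 \<le> n" and T: "1 \<le> T"
    and low: "lower_bounded_gap F Fstar x1 \<Delta>" and smooth: "L_smooth L F gradF"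
    and bcm: "p_BCM D gradf gradF p \<sigma>" and iid: "iid_samples M D \<xi> T (\<lambda>_. n)"
  defines "X \<equiv> minibatch_nsgd gradf (\<lambda>_. h) (\<lambda>_. n) \<xi> x1"
  shows "\<forall>t\<in>{1..T}. integrable M (\<lambda>\<omega>. norm (gradF (X t \<omega>)))" (is ?int)
    and "avg_grad_norm M gradF X T \<le>
      \<Delta> / (h * real T) + h * L / 2 + 4 * \<sigma> / real n powr ((p - 1) / p)" (is ?bound)
proof -
  have M: "prob_space M"
    and gradf [measurable]: "(\<lambda>(x, s). gradf x s) \<in> borel_measurable (borel \<Otimes>\<^sub>M D)"
    using iid bcm by (auto simp: iid_samples_def p_BCM_def)
  interpret prob_space M by fact
  have lip: "lipschitz_on L UNIV gradF"
    using smooth by (simp add: L_smooth_def)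
  have gradF [measurable]: "gradF \<in> borel_measurable borel"
    using lip by (intro borel_measurable_continuous_onI lipschitz_on_continuous_on)
  have \<xi>: "\<xi> t j \<in> measurable M D" if "t \<in> {1..T}" "j \<in> {1..n}" for t j
  proof -
    have "indep_vars (\<lambda>_. D) (\<lambda>(t, j). \<xi> t j) (SIGMA t:{1..T}. {1..n})"
      using iid by (simp add: iid_samples_def)
    then show ?thesis
      using that by (force simp: indep_vars_def)
  qed
  have X: "X t \<in> borel_measurable M" if "t \<in> {1..T}" for t
    unfolding X_def by (rule borel_measurable_minibatch_nsgd[OF gradf]) (use \<xi> that in auto)
  let ?e = "\<lambda>t \<omega>. norm (minibatch_grad gradf n (\<lambda>j. \<xi> t j \<omega>) (X t \<omega>) - gradF (X t \<omega>))"
  define c where "c = 2 * \<sigma> / real n powr ((p - 1) / p)"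
  have c: "c \<ge> 0" using nonneg by (simp add: c_def)
  have e: "integrable M (?e t)" "expectation (?e t) \<le> c" if t: "t \<in> {1..T}" for t
  proof -
    have le: "(\<integral>\<^sup>+\<omega>. ennreal (?e t \<omega>) \<partial>M) \<le> ennreal c"
      unfolding X_def c_def
      by (rule nn_integral_nsgd_error_le[OF bcm p nonneg(1) gradF iid t n])
    have [measurable]: "X t \<in> borel_measurable M" "\<And>j. j \<in> {1..n} \<Longrightarrow> \<xi> t j \<in> measurable M D"
      using X \<xi> t by auto
    have meas: "?e t \<in> borel_measurable M"
      unfolding minibatch_grad_def by measurable
    show int: "integrable M (?e t)"
      using le by (intro integrableI_nonneg meas) (auto simp: le_less_trans)
    have "ennreal (expectation (?e t)) \<le> ennreal c"
      using le nn_integral_eq_integral[OF int] by simp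
    then show "expectation (?e t) \<le> c"
      using c by (simp add: ennreal_le_iff)
  qed
  have grad: "integrable M (\<lambda>\<omega>. norm (gradF (X t \<omega>)))" if t: "t \<in> {1..T}" for t
  proof (rule integrable_const_bound)
    have [measurable]: "X t \<in> borel_measurable M"
      using X t by auto
    show "(\<lambda>\<omega>. norm (gradF (X t \<omega>))) \<in> borel_measurable M"
      by measurable
    have "norm (gradF (X t \<omega>)) \<le> norm (gradF x1) + L * (real t * h)" for \<omega>
    proof -
      have "norm (gradF (X t \<omega>) - gradF x1) \<le> L * norm (X t \<omega> - x1)"
        using lip by (auto simp: lipschitz_on_def dist_norm)
      also have "\<dots> \<le> L * (real t * h)"
        unfolding X_def using h nonneg by (intro mult_left_mono norm_minibatch_nsgd_diff_le) auto
      finally show ?thesis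
        using norm_triangle_sub[of "gradF (X t \<omega>)" "gradF x1"] by simp
    qed
    then show "AE \<omega> in M. norm (norm (gradF (X t \<omega>))) \<le> norm (gradF x1) + L * (real t * h)"
      by simp
  qed
  then show ?int by simp
  have "h * (\<Sum>t=1..T. expectation (\<lambda>\<omega>. norm (gradF (X t \<omega>)))) =
      expectation (\<lambda>\<omega>. h * (\<Sum>t=1..T. norm (gradF (X t \<omega>))))"
    using grad by simp
  also have "\<dots> \<le> expectation (\<lambda>\<omega>. \<Delta> + real T * (h\<^sup>2 * L / 2) + 2 * h * (\<Sum>t=1..T. ?e t \<omega>))"
  proof (rule integral_mono)
    show "integrable M (\<lambda>\<omega>. h * (\<Sum>t=1..T. norm (gradF (X t \<omega>))))"
      using grad by (intro integrable_mult_right Bochner_Integration.integrable_sum) auto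
    show "integrable M (\<lambda>\<omega>. \<Delta> + real T * (h\<^sup>2 * L / 2) + 2 * h * (\<Sum>t=1..T. ?e t \<omega>))"
      using e(1) by (intro Bochner_Integration.integrable_add integrable_mult_right
          Bochner_Integration.integrable_sum integrable_const) auto
    fix \<omega>
    \<comment> \<open>The lower bound is applied at the point reached after the last of the
      \<open>T\<close> steps.\<close>
    have "F x1 - F (X (Suc T) \<omega>) \<le> \<Delta>"
      using low by (auto simp: lower_bounded_gap_def intro: order_trans[rotated])
    then show "h * (\<Sum>t=1..T. norm (gradF (X t \<omega>))) \<le>
        \<Delta> + real T * (h\<^sup>2 * L / 2) + 2 * h * (\<Sum>t=1..T. ?e t \<omega>)"
      using nsgd_sum_grad_norm_le[OF smooth nonneg(2) h, where gradf=gradf and b="\<lambda>_. n" and \<xi>=\<xi>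
          and ?x1.0=x1 and \<omega>=\<omega> and T=T]
      unfolding X_def by linarith
  qed
  also have "\<dots> = \<Delta> + real T * (h\<^sup>2 * L / 2) + 2 * h * (\<Sum>t=1..T. expectation (?e t))"
  proof -
    have affine: "expectation (\<lambda>\<omega>. k + l * f \<omega>) = k + l * expectation f" if "integrable M f" for k l and f :: "_ \<Rightarrow> real"
      using that by (simp add: prob_space)
    have "integrable M (\<lambda>\<omega>. \<Sum>t=1..T. ?e t \<omega>)"
      using e(1) by (intro Bochner_Integration.integrable_sum) auto
    moreover have "expectation (\<lambda>\<omega>. \<Sum>t=1..T. ?e t \<omega>) = (\<Sum>t=1..T. expectation (?e t))"
      using e(1) by (intro Bochner_Integration.integral_sum) auto
    ultimately show ?thesis
      by (simp only: affine)
  qed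
  also have "\<dots> \<le> \<Delta> + real T * (h\<^sup>2 * L / 2) + 2 * h * (real T * c)"
    using sum_mono[of "{1..T}" "\<lambda>t. expectation (?e t)" "\<lambda>_. c"] e(2) h by simp
  finally have "avg_grad_norm M gradF X T \<le>
      (\<Delta> + real T * (h\<^sup>2 * L / 2) + 2 * h * (real T * c)) / (h * real T)"
    using h T by (simp add: avg_grad_norm_def field_simps)
  \<comment> \<open>The final constant 4 is this 2, from the normalized descent step, times the 2
    inside \<open>c\<close>, from the moment bound.\<close>
  also have "\<dots> = \<Delta> / (h * real T) + h * L / 2 + 2 * c"
    using h T by (simp add: field_simps power2_eq_square)
  finally show ?bound
    by (simp add: c_def)
qed

section \<open>Rate and sample complexity for the prescribed parameters\<close>

text \<open>Rounding \<open>m\<close> up to the integer batch size \<open>n\<close> can only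
  decrease the noise term, so the bound may be stated in \<open>m\<close>.\<close>

lemma nsgd_convergence_rate:
  fixes gradf :: "'a::euclidean_space \<Rightarrow> 's \<Rightarrow> 'a" and B q r :: real
  assumes p: "1 < p" "p \<le> 2" and nonneg: "0 \<le> \<sigma>" "0 \<le> L" and "0 < \<eta>" and T: "1 \<le> T"
    and low: "lower_bounded_gap F Fstar x1 \<Delta>" and smooth: "L_smooth L F gradF"
    and bcm: "p_BCM D gradf gradF p \<sigma>" and iid: "iid_samples M D \<xi> T (nsgd_batch B q T)"
  defines "X \<equiv> minibatch_nsgd gradf (nsgd_step \<eta> r T) (nsgd_batch B q T) \<xi> x1"
  shows "\<forall>t\<in>{1..T}. integrable M (\<lambda>\<omega>. norm (gradF (X t \<omega>)))"
    and "avg_grad_norm M gradF X T \<le>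
      \<Delta> / (\<eta> * real T powr (1 - r)) + \<eta> * L / (2 * real T powr r) +
      4 * \<sigma> / (max 1 (B * real T powr q)) powr ((p - 1) / p)"
proof -
  define m where "m = max 1 (B * real T powr q)"
  define n where "n = nat \<lceil>m\<rceil>"
  define h where "h = \<eta> * real T powr (- r)"
  have "m \<ge> 1" by (simp add: m_def)
  then have n: "m \<le> real n" "1 \<le> n"
    by (auto simp: n_def le_nat_iff)
  have h: "0 < h" using \<open>0 < \<eta>\<close> T by (simp add: h_def)
  have batch: "nsgd_batch B q T = (\<lambda>_. n)" and step: "nsgd_step \<eta> r T = (\<lambda>_. h)"
    by (simp_all add: nsgd_batch_def nsgd_step_def n_def m_def h_def)
  note conv = nsgd_convergence[OF p nonneg h n(2) T low smooth bcm iid[unfolded batch]]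
  show "\<forall>t\<in>{1..T}. integrable M (\<lambda>\<omega>. norm (gradF (X t \<omega>)))"
    unfolding X_def batch step by (rule conv(1))
  have "avg_grad_norm M gradF X T \<le> \<Delta> / (h * real T) + h * L / 2 + 4 * \<sigma> / real n powr ((p - 1) / p)"
    unfolding X_def batch step by (rule conv(2))
  also have "\<Delta> / (h * real T) = \<Delta> / (\<eta> * real T powr (1 - r))"
    using T by (simp add: h_def powr_diff powr_minus field_simps)
  also have "h * L / 2 = \<eta> * L / (2 * real T powr r)"
    using T by (simp add: h_def powr_minus field_simps)
  also have "4 * \<sigma> / real n powr ((p - 1) / p) \<le> 4 * \<sigma> / m powr ((p - 1) / p)"
    using n \<open>m \<ge> 1\<close> p nonneg by (intro divide_left_mono powr_mono2 mult_pos_pos) auto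
  finally show "avg_grad_norm M gradF X T \<le>
      \<Delta> / (\<eta> * real T powr (1 - r)) + \<eta> * L / (2 * real T powr r) +
      4 * \<sigma> / (max 1 (B * real T powr q)) powr ((p - 1) / p)"
    by (simp add: m_def)
qed

lemma le_powr_of_powr_inverse_le:
  fixes y a t :: real
  assumes "0 \<le> y" "0 < a" "y powr (1 / a) \<le> t"
  shows "y \<le> t powr a"
proof -
  have "y = (y powr (1 / a)) powr a"
    using assms by (simp add: powr_powr)
  also have "\<dots> \<le> t powr a"
    using assms by (intro powr_mono2) auto
  finally show ?thesis .
qed

text \<open>A statement about real parameters alone, so one horizon serves every problem instance.
  The witness is the rounded maximum of three real horizons, each of which brings one term of the
  rate down to \<open>\<epsilon> / 3\<close>.\<close>

lemma nsgd_horizon_exists: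
  fixes p q r \<eta> B \<Delta> L \<sigma> \<epsilon> :: real
  assumes p: "1 < p" and "0 \<le> \<sigma>" "0 \<le> L" "0 < q" and \<eta>: "0 < \<eta>" and B: "0 < B"
    and r: "0 < r" "r < 1" and "0 < \<Delta>" and \<epsilon>: "0 < \<epsilon>" "\<epsilon> \<le> accuracy_threshold \<eta> B q r \<Delta>"
  shows "\<exists>T\<ge>1.
    real (oracle_calls (nsgd_batch B q T) T) \<le> complexity_const \<eta> B q r p *
      ((\<Delta> / \<epsilon>) powr ((1 + q) / (1 - r)) + (L / \<epsilon>) powr ((1 + q) / r)
        + (\<sigma> / \<epsilon>) powr (p * (1 + q) / (q * (p - 1)))) \<and>
    \<Delta> / (\<eta> * real T powr (1 - r)) + \<eta> * L / (2 * real T powr r) +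
      4 * \<sigma> / (max 1 (B * real T powr q)) powr ((p - 1) / p) \<le> \<epsilon>"
proof -
  \<comment> \<open>These are the values that \<open>T powr (1 - r)\<close>, \<open>T powr r\<close>
    and \<open>(B * T powr q) powr ((p - 1) / p)\<close> must reach. The exponent \<open>s\<close>
    below inverts \<open>(p - 1) / p\<close>.\<close>
  define y1 y2 y3 where "y1 = 3 * \<Delta> / (\<eta> * \<epsilon>)" and "y2 = 3 * \<eta> * L / (2 * \<epsilon>)" and "y3 = 12 * \<sigma> / \<epsilon>"
  define s where "s = p / (p - 1)"
  define T1 T2 T3 where "T1 = y1 powr (1 / (1 - r))" and "T2 = y2 powr (1 / r)"
    and "T3 = (y3 powr s / B) powr (1 / q)"
  define U where "U = max T1 (max T2 T3)"
  define T where "T = nat \<lceil>U\<rceil>"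
  have y: "0 \<le> y1" "0 \<le> y2" "0 \<le> y3"
    using assms by (auto simp: y1_def y2_def y3_def)
  have s: "s > 0" using p by (simp add: s_def)

  \<comment> \<open>The two entries of the minimum in the threshold give two lower bounds on
    \<open>y1\<close>. They become \<open>1 \<le> T1\<close> and
    \<open>(1 / B) powr (1 / q) \<le> T1\<close>.\<close>
  have min: "\<epsilon> \<le> 3 * \<Delta> / \<eta> * z" if "min 1 (B powr ((1 - r) / q)) \<le> z" for z
    using mult_left_mono[OF that, of "3 * \<Delta> / \<eta>"] \<epsilon>(2) \<eta> \<open>0 < \<Delta>\<close>
    unfolding accuracy_threshold_def by (auto intro: order_trans)
  have "\<epsilon> \<le> 3 * \<Delta> / \<eta> * 1" "\<epsilon> \<le> 3 * \<Delta> / \<eta> * B powr ((1 - r) / q)"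
    by (rule min, simp)+
  moreover have "B powr (- (1 - r) / q) = 1 / B powr ((1 - r) / q)"
    unfolding minus_divide_left[symmetric] by (rule powr_minus_divide)
  ultimately have y1: "1 \<le> y1" "B powr (- (1 - r) / q) \<le> y1"
    using \<eta> \<epsilon>(1) B by (simp_all add: y1_def divide_le_eq le_divide_eq mult_ac)
  have "1 \<le> T1"
    using y1(1) r by (simp add: T1_def ge_one_powr_ge_zero)
  have "(B powr (- (1 - r) / q)) powr (1 / (1 - r)) \<le> T1"
    unfolding T1_def using y1(2) r by (intro powr_mono2) auto
  also have "(B powr (- (1 - r) / q)) powr (1 / (1 - r)) = (1 / B) powr (1 / q)"
  proof -
    have "- (1 - r) / q * (1 / (1 - r)) = - (1 / q)"
      using r \<open>0 < q\<close> by (simp add: divide_simps)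
    then have "(B powr (- (1 - r) / q)) powr (1 / (1 - r)) = B powr (- (1 / q))"
      by (simp only: powr_powr)
    also have "\<dots> = (1 / B) powr (1 / q)"
      using B by (simp add: powr_minus_divide powr_divide)
    finally show ?thesis .
  qed
  finally have BT1: "(1 / B) powr (1 / q) \<le> T1" .
  have U: "1 \<le> U" "T1 \<le> U" "T2 \<le> U" "T3 \<le> U"
    using \<open>1 \<le> T1\<close> by (auto simp: U_def)
  have T: "1 \<le> T" "U \<le> real T"
    using U(1) by (auto simp: T_def le_nat_iff)
  \<comment> \<open>Rounding up a real number that is at least 1 at most doubles it. This is used
    for \<open>T\<close> here and for the batch size below, giving the factor
    \<open>2 powr (1 + q) * 2\<close> in the constant.\<close>
  have "real T = of_int \<lceil>U\<rceil>"
    using U(1) by (simp add: T_def)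
  then have T2U: "real T \<le> 2 * U"
    using U(1) of_int_ceiling_le_add_one[of U] by linarith
  have BT: "1 \<le> B * real T powr q"
    using le_powr_of_powr_inverse_le[of "1 / B" q "real T"] BT1 U T \<open>0 < q\<close> B
    by (simp add: field_simps)
  have "real (nsgd_batch B q T t) = of_int \<lceil>B * real T powr q\<rceil>" for t
    using BT by (simp add: nsgd_batch_def max_def)
  then have batch: "real (nsgd_batch B q T t) \<le> 2 * (B * real T powr q)" for t
    using BT of_int_ceiling_le_add_one[of "B * real T powr q"] by simp linarith

  have "real (oracle_calls (nsgd_batch B q T) T) \<le> real T * (2 * (B * real T powr q))"
    using sum_mono[of "{1..T}" "\<lambda>t. real (nsgd_batch B q T t)", OF batch]
    by (simp add: oracle_calls_def)
  also have "\<dots> = 2 * B * real T powr (1 + q)"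
    using T by (simp add: powr_add)
  also have "\<dots> \<le> 2 * B * (2 * U) powr (1 + q)"
    using T2U B \<open>0 < q\<close> by (intro mult_left_mono powr_mono2) auto
  also have "\<dots> = 2 powr (2 + q) * B * U powr (1 + q)"
    using U by (simp add: powr_mult powr_add)
  \<comment> \<open>\<open>U\<close> is one of the three horizons, so its power is at most the sum
    of their powers.\<close>
  also have "\<dots> \<le> 2 powr (2 + q) * B * (T1 powr (1 + q) + T2 powr (1 + q) + T3 powr (1 + q))"
    using B by (intro mult_left_mono) (auto simp: U_def max_def)
  also have "T1 powr (1 + q) = (3 / \<eta>) powr ((1 + q) / (1 - r)) * (\<Delta> / \<epsilon>) powr ((1 + q) / (1 - r))"
    using powr_mult[of "3 / \<eta>" "\<Delta> / \<epsilon>" "(1 + q) / (1 - r)"] assms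
    by (simp add: T1_def y1_def powr_powr)
  also have "T2 powr (1 + q) = (3 * \<eta> / 2) powr ((1 + q) / r) * (L / \<epsilon>) powr ((1 + q) / r)"
    using powr_mult[of "3 * \<eta> / 2" "L / \<epsilon>" "(1 + q) / r"] assms
    by (simp add: T2_def y2_def powr_powr)
  also have "T3 powr (1 + q) = (1 / B) powr ((1 + q) / q) * 12 powr (p * (1 + q) / (q * (p - 1))) *
      (\<sigma> / \<epsilon>) powr (p * (1 + q) / (q * (p - 1)))"
  proof -
    have "T3 powr (1 + q) = (1 / B * y3 powr s) powr ((1 + q) / q)"
      by (simp add: T3_def powr_powr)
    also have "\<dots> = (1 / B) powr ((1 + q) / q) * y3 powr (s * ((1 + q) / q))"
      using B y by (subst powr_mult) (auto simp: powr_powr)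
    also have "s * ((1 + q) / q) = p * (1 + q) / (q * (p - 1))"
      by (simp add: s_def)
    also have "y3 = 12 * (\<sigma> / \<epsilon>)"
      by (simp add: y3_def)
    also have "(12 * (\<sigma> / \<epsilon>)) powr (p * (1 + q) / (q * (p - 1))) =
        12 powr (p * (1 + q) / (q * (p - 1))) * (\<sigma> / \<epsilon>) powr (p * (1 + q) / (q * (p - 1)))"
      using assms by (intro powr_mult)
    finally show ?thesis by (simp only: mult.assoc)
  qed
  also have "2 powr (2 + q) * B *
      ((3 / \<eta>) powr ((1 + q) / (1 - r)) * (\<Delta> / \<epsilon>) powr ((1 + q) / (1 - r)) +
       (3 * \<eta> / 2) powr ((1 + q) / r) * (L / \<epsilon>) powr ((1 + q) / r) +
       (1 / B) powr ((1 + q) / q) * 12 powr (p * (1 + q) / (q * (p - 1))) *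
         (\<sigma> / \<epsilon>) powr (p * (1 + q) / (q * (p - 1)))) \<le>
    complexity_const \<eta> B q r p *
      ((\<Delta> / \<epsilon>) powr ((1 + q) / (1 - r)) + (L / \<epsilon>) powr ((1 + q) / r)
        + (\<sigma> / \<epsilon>) powr (p * (1 + q) / (q * (p - 1))))"
  \<comment> \<open>The sum of three products is bounded by the product of the sums, which merges
    the separate coefficients into one constant.\<close>
  proof -
    have "a1 * b1 + a2 * b2 + a3 * b3 \<le> (a1 + a2 + a3) * (b1 + b2 + b3)"
      if "0 \<le> a1" "0 \<le> a2" "0 \<le> a3" "0 \<le> b1" "0 \<le> b2" "0 \<le> b3" for a1 a2 a3 b1 b2 b3 :: real
      using that by (simp add: algebra_simps add_nonneg_nonneg)
    then show ?thesis
      unfolding complexity_const_def mult.assoc[of "2 powr (2 + q) * B"]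
      using B by (intro mult_left_mono) auto
  qed
  finally have calls: "real (oracle_calls (nsgd_batch B q T) T) \<le> complexity_const \<eta> B q r p *
      ((\<Delta> / \<epsilon>) powr ((1 + q) / (1 - r)) + (L / \<epsilon>) powr ((1 + q) / r)
        + (\<sigma> / \<epsilon>) powr (p * (1 + q) / (q * (p - 1))))" .

  have "y1 \<le> real T powr (1 - r)"
    using le_powr_of_powr_inverse_le[of y1 "1 - r" "real T"] y r U T by (simp add: T1_def)
  then have term1: "\<Delta> / (\<eta> * real T powr (1 - r)) \<le> \<epsilon> / 3"
    using \<eta> \<epsilon>(1) T by (simp add: y1_def field_simps)
  have "y2 \<le> real T powr r"
    using le_powr_of_powr_inverse_le[of y2 r "real T"] y r U T by (simp add: T2_def)
  then have term2: "\<eta> * L / (2 * real T powr r) \<le> \<epsilon> / 3"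
    using \<epsilon>(1) T by (simp add: y2_def field_simps)
  have "y3 powr s / B \<le> real T powr q"
    using le_powr_of_powr_inverse_le[of "y3 powr s / B" q "real T"] B \<open>0 < q\<close> U T
    by (simp add: T3_def)
  then have "y3 powr s \<le> B * real T powr q"
    using B by (simp add: field_simps)
  then have "y3 \<le> (B * real T powr q) powr ((p - 1) / p)"
    using le_powr_of_powr_inverse_le[of y3 "(p - 1) / p"] y p by (simp add: s_def)
  moreover have "0 < (B * real T powr q) powr ((p - 1) / p)"
    using B T by simp
  ultimately have "4 * \<sigma> / (B * real T powr q) powr ((p - 1) / p) \<le> \<epsilon> / 3"
    using \<epsilon>(1) by (simp add: y3_def field_simps)
  then have term3: "4 * \<sigma> / (max 1 (B * real T powr q)) powr ((p - 1) / p) \<le> \<epsilon> / 3"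
    using BT by (simp add: max_def)
  from term1 term2 term3 calls T(1) show ?thesis
    by (intro exI[of _ T]) auto
qed

text \<open>In the complexity part \<open>T\<close> is chosen before the function, the oracle and
  the probability space, so it depends only on the numerical parameters.\<close>

theorem proposition1:
  fixes p q r \<eta> B \<Delta>1 L \<sigma> :: real
  assumes "1 < p" and "p \<le> 2" and "0 \<le> \<sigma>" and "0 \<le> L"
    and "0 \<le> q" and "0 < \<eta>" and "0 < B" and "0 < r" and "r < 1"
  shows
    "(\<forall>(F :: 'a::euclidean_space \<Rightarrow> real) gradF Fstar x1
        (D :: 's measure) gradf (M :: 'w measure) \<xi> T.
        lower_bounded_gap F Fstar x1 \<Delta>1 \<and> L_smooth L F gradF \<and>
        p_BCM D gradf gradF p \<sigma> \<and> 1 \<le> T \<and> iid_samples M D \<xi> T (nsgd_batch B q T) \<longrightarrow>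
        (let X = minibatch_nsgd gradf (nsgd_step \<eta> r T) (nsgd_batch B q T) \<xi> x1 in
           (\<forall>t\<in>{1..T}. integrable M (\<lambda>\<omega>. norm (gradF (X t \<omega>)))) \<and>
           avg_grad_norm M gradF X T
             \<le> \<Delta>1 / (\<eta> * real T powr (1 - r)) + \<eta> * L / (2 * real T powr r)
               + 4 * \<sigma> / (max 1 (B * real T powr q)) powr ((p - 1) / p)))
     \<and>
     (0 < q \<and> 0 < \<Delta>1 \<longrightarrow>
       (\<forall>\<epsilon>. 0 < \<epsilon> \<and> \<epsilon> \<le> accuracy_threshold \<eta> B q r \<Delta>1 \<longrightarrow>
         (\<exists>T\<ge>1.
           real (oracle_calls (nsgd_batch B q T) T)
             \<le> complexity_const \<eta> B q r p *
                 ((\<Delta>1 / \<epsilon>) powr ((1 + q) / (1 - r)) + (L / \<epsilon>) powr ((1 + q) / r)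
                  + (\<sigma> / \<epsilon>) powr (p * (1 + q) / (q * (p - 1)))) \<and>
           (\<forall>(F :: 'a \<Rightarrow> real) gradF Fstar x1
              (D :: 's measure) gradf (M :: 'w measure) \<xi>.
              lower_bounded_gap F Fstar x1 \<Delta>1 \<and> L_smooth L F gradF \<and>
              p_BCM D gradf gradF p \<sigma> \<and> iid_samples M D \<xi> T (nsgd_batch B q T) \<longrightarrow>
              avg_grad_norm M gradF
                (minibatch_nsgd gradf (nsgd_step \<eta> r T) (nsgd_batch B q T) \<xi> x1) T \<le> \<epsilon>))))"
proof (intro conjI allI impI)
  fix F :: "'a \<Rightarrow> real" and gradF Fstar x1
    and D :: "'s measure" and gradf and M :: "'w measure" and \<xi> T
  assume "lower_bounded_gap F Fstar x1 \<Delta>1 \<and> L_smooth L F gradF \<and>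
    p_BCM D gradf gradF p \<sigma> \<and> 1 \<le> T \<and> iid_samples M D \<xi> T (nsgd_batch B q T)"
  then show "let X = minibatch_nsgd gradf (nsgd_step \<eta> r T) (nsgd_batch B q T) \<xi> x1 in
      (\<forall>t\<in>{1..T}. integrable M (\<lambda>\<omega>. norm (gradF (X t \<omega>)))) \<and>
      avg_grad_norm M gradF X T
        \<le> \<Delta>1 / (\<eta> * real T powr (1 - r)) + \<eta> * L / (2 * real T powr r)
          + 4 * \<sigma> / (max 1 (B * real T powr q)) powr ((p - 1) / p)"
    unfolding Let_def
    using nsgd_convergence_rate[OF assms(1-4,6), of T F Fstar x1 \<Delta>1 gradF D gradf M \<xi> B q r] by blast
next
  fix \<epsilon>
  assume "0 < q \<and> 0 < \<Delta>1" and "0 < \<epsilon> \<and> \<epsilon> \<le> accuracy_threshold \<eta> B q r \<Delta>1"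
  then obtain T where "1 \<le> T"
    and calls: "real (oracle_calls (nsgd_batch B q T) T)
      \<le> complexity_const \<eta> B q r p *
          ((\<Delta>1 / \<epsilon>) powr ((1 + q) / (1 - r)) + (L / \<epsilon>) powr ((1 + q) / r)
           + (\<sigma> / \<epsilon>) powr (p * (1 + q) / (q * (p - 1))))"
    and le: "\<Delta>1 / (\<eta> * real T powr (1 - r)) + \<eta> * L / (2 * real T powr r) +
      4 * \<sigma> / (max 1 (B * real T powr q)) powr ((p - 1) / p) \<le> \<epsilon>"
    using nsgd_horizon_exists[OF assms(1,3,4) _ assms(6-9), of q \<Delta>1 \<epsilon>] by auto
  show "\<exists>T\<ge>1.
      real (oracle_calls (nsgd_batch B q T) T)
        \<le> complexity_const \<eta> B q r p *
            ((\<Delta>1 / \<epsilon>) powr ((1 + q) / (1 - r)) + (L / \<epsilon>) powr ((1 + q) / r)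
             + (\<sigma> / \<epsilon>) powr (p * (1 + q) / (q * (p - 1)))) \<and>
      (\<forall>(F :: 'a \<Rightarrow> real) gradF Fstar x1
         (D :: 's measure) gradf (M :: 'w measure) \<xi>.
         lower_bounded_gap F Fstar x1 \<Delta>1 \<and> L_smooth L F gradF \<and>
         p_BCM D gradf gradF p \<sigma> \<and> iid_samples M D \<xi> T (nsgd_batch B q T) \<longrightarrow>
         avg_grad_norm M gradF
           (minibatch_nsgd gradf (nsgd_step \<eta> r T) (nsgd_batch B q T) \<xi> x1) T \<le> \<epsilon>)"
  proof (intro exI[of _ T] conjI allI impI \<open>1 \<le> T\<close> calls, elim conjE)
    fix F :: "'a \<Rightarrow> real" and gradF Fstar x1
      and D :: "'s measure" and gradf and M :: "'w measure" and \<xi>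
    assume "lower_bounded_gap F Fstar x1 \<Delta>1" "L_smooth L F gradF"
      "p_BCM D gradf gradF p \<sigma>" "iid_samples M D \<xi> T (nsgd_batch B q T)"
    from nsgd_convergence_rate(2)[OF assms(1-4,6) \<open>1 \<le> T\<close> this] le
    show "avg_grad_norm M gradF
        (minibatch_nsgd gradf (nsgd_step \<eta> r T) (nsgd_batch B q T) \<xi> x1) T \<le> \<epsilon>"
      by (rule order_trans)
  qed
qed

end
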